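(* Let $(\mathcal S,\mathcal A,\mathcal T,\gamma,\lambda)$ be an entropy-regularized infinite-horizon discounted MDP environment with $\mathcal S,\mathcal A$ finite, $|\mathcal S|,|\mathcal A|\ge2$, $\gamma\in[0,1)$, $\lambda>0$. Suppose that either the transitions are deterministic, i.e. $\mathcal T(s'|s,a)\in\{0,1\}$ for all $s,s',a$, or we have at least as many actions (with linearly independent resulting transition probabilities) as we have possible future states, that is, for every $s\in\mathcal S$, $$\mathrm{rank}\{\mathcal T(\cdot|s,a);\ a\in\mathcal A\}=\#\{s':\mathcal T(s'|s,a)>0\text{ for some }a\in\mathcal A\}.$$ Let $\bar\pi$ be an observed policy which is the entropy-regularized optimal policy for some action-independent reward. Then the (action-independent) IRL problem is identifiable (i.e. the true action-independent reward function $f:\mathcal S\to\mathbb R$ can be inferred from $\bar\pi$ up to a constant shift) if and only if the MDP is reward-decomposable.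
   Context: Reward-decomposability: states $s_1,s_1'$ are 1-step linked if there exist actions $a,a'\in\mathcal A$ and a state $s_0\in\mathcal S$ with $\mathcal T(s_1|s_0,a)>0$ and $\mathcal T(s_1'|s_0,a')>0$. This definition is extended through transitivity, forming sets of linked states. The MDP is reward-decomposable if all its states are linked. The rank is the dimension of the linear span in $\mathbb R^{\mathcal S}$ of the probability vectors $\mathcal T(\cdot|s,a)$, $a\in\mathcal A$. Entropy-regularized MDP with reward $f$: policies are maps $\pi:\mathcal S\to\mathcal P(\mathcal A)$ (probability distributions on $\mathcal A$); the optimal value is $V^*_\lambda(s)=\max_\pi\mathbb E^\pi_s\big[\sum_{t\ge0}\gamma^t(f(S_t,A_t)-\lambda\log\pi(A_t|S_t))\big]$, where $S_0=s$, $A_t\sim\pi(\cdot|S_t)$, $S_{t+1}\sim\mathcal T(\cdot|S_t,A_t)$. Standard facts: $V^*_\lambda(s)=\lambda\log\sum_a\exp(Q^*_\lambda(s,a)/\lambda)$ with $Q^*_\lambda(s,a)=f(s,a)+\gamma\sum_{s'}\mathcal T(s'|s,a)V^*_\lambda(s')$, and the entropy-regularized optimal policy is $\pi^*_\lambda(a|s)=\exp\big((Q^*_\lambda(s,a)-V^*_\lambda(s))/\lambda\big)$. A reward is action-independent if $f(s,a)=f(s)$ does not depend on $a$.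
   Formalization: The discount factor is taken in (0,1) instead of [0,1): at γ = 0 the uniform policy is optimal for every action-independent reward, so the reward is never identifiable, although the MDP may be deterministic and reward-decomposable. *)

theory Defs
  imports "HOL-Probability.Probability"
begin

definition one_step_linked :: "('s \<Rightarrow> 'a \<Rightarrow> 's pmf) \<Rightarrow> 's \<Rightarrow> 's \<Rightarrow> bool" where
  "one_step_linked T s1 s1' \<longleftrightarrow>
     (\<exists>a a' s0. pmf (T s0 a) s1 > 0 \<and> pmf (T s0 a') s1' > 0)"

text \<open>
  Linkedness is the transitive closure. Reflexivity is not added: a state without a
  predecessor is linked to no state at all.
\<close>

definition linked :: "('s \<Rightarrow> 'a \<Rightarrow> 's pmf) \<Rightarrow> 's \<Rightarrow> 's \<Rightarrow> bool" where
  "linked T = (one_step_linked T)\<^sup>+\<^sup>+"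

definition reward_decomposable :: "('s \<Rightarrow> 'a \<Rightarrow> 's pmf) \<Rightarrow> bool" where
  "reward_decomposable T \<longleftrightarrow> (\<forall>s s'. linked T s s')"

definition deterministic_transitions :: "('s \<Rightarrow> 'a \<Rightarrow> 's pmf) \<Rightarrow> bool" where
  "deterministic_transitions T \<longleftrightarrow> (\<forall>s a s'. pmf (T s a) s' \<in> {0, 1})"

definition transition_rank :: "('s::finite \<Rightarrow> 'a \<Rightarrow> 's pmf) \<Rightarrow> 's \<Rightarrow> nat" where
  "transition_rank T s =
     dim (span (range (\<lambda>a. (\<chi> s'. pmf (T s a) s') :: real ^ 's)))"

definition future_states :: "('s \<Rightarrow> 'a \<Rightarrow> 's pmf) \<Rightarrow> 's \<Rightarrow> 's set" where
  "future_states T s = {s'. \<exists>a. pmf (T s a) s' > 0}"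

definition state_action_pmf :: "('s \<Rightarrow> 'a pmf) \<Rightarrow> 's pmf \<Rightarrow> ('s \<times> 'a) pmf" where
  "state_action_pmf p D = bind_pmf D (\<lambda>s. map_pmf (\<lambda>a. (s, a)) (p s))"

text \<open>
  Conditional law of \<open>(S\<^sub>n, A\<^sub>n)\<close> given the history
  \<open>h = ((S\<^sub>0, A\<^sub>0), \<dots>, (S\<^sub>n\<^sub>-\<^sub>1, A\<^sub>n\<^sub>-\<^sub>1))\<close>, when the initial state
  is \<open>s\<close> and the stationary policy \<open>p\<close> is followed.
\<close>

fun trajectory_kernel ::
  "('s \<Rightarrow> 'a \<Rightarrow> 's pmf) \<Rightarrow> ('s \<Rightarrow> 'a pmf) \<Rightarrow> 's \<Rightarrow> nat \<Rightarrow> (nat \<Rightarrow> 's \<times> 'a) \<Rightarrow> ('s \<times> 'a) measure"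
where
  "trajectory_kernel T p s 0 h = measure_pmf (state_action_pmf p (return_pmf s))"
| "trajectory_kernel T p s (Suc n) h =
     measure_pmf (state_action_pmf p (T (fst (h n)) (snd (h n))))"

text \<open>
  The law of the whole process \<open>(S\<^sub>t, A\<^sub>t)\<^sub>t\<close>: the projective limit given by the
  Ionescu-Tulcea theorem, whose hypotheses are checked in the lemma below.
\<close>

definition trajectory_measure ::
  "('s \<Rightarrow> 'a \<Rightarrow> 's pmf) \<Rightarrow> ('s \<Rightarrow> 'a pmf) \<Rightarrow> 's \<Rightarrow> (nat \<Rightarrow> 's \<times> 'a) measure"
where
  "trajectory_measure T p s =
     projective_family.lim UNIV
       (Ionescu_Tulcea.CI (trajectory_kernel T p s) (\<lambda>_. count_space UNIV))
       (\<lambda>_. count_space UNIV)"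

lemma Ionescu_Tulcea_trajectory_kernel:
  fixes T :: "'s::finite \<Rightarrow> 'a::finite \<Rightarrow> 's pmf"
  shows "Ionescu_Tulcea (trajectory_kernel T p s) (\<lambda>_. count_space UNIV)"
proof (rule Ionescu_Tulcea.intro)
  fix i :: nat
  let ?M = "\<lambda>_::nat. count_space (UNIV :: ('s \<times> 'a) set)"
  show "trajectory_kernel T p s i \<in> measurable (PiM {0..<i} ?M) (subprob_algebra (?M i))"
  proof (cases i)
    case 0
    have "trajectory_kernel T p s 0 = (\<lambda>_. measure_pmf (state_action_pmf p (return_pmf s)))"
      by (rule ext) simp
    with 0 show ?thesis
      by (simp add: measure_pmf_in_subprob_algebra del: trajectory_kernel.simps)
  next
    case (Suc n)
    have "(\<lambda>x. measure_pmf (state_action_pmf p (T (fst x) (snd x))))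
            \<in> measurable (count_space UNIV) (subprob_algebra (count_space UNIV))"
      by (simp add: measure_pmf_in_subprob_algebra)
    moreover have "(\<lambda>h. h n) \<in> measurable (PiM {0..<Suc n} ?M) (count_space UNIV)"
      by (rule measurable_component_singleton) simp
    ultimately have "(\<lambda>h. measure_pmf (state_action_pmf p (T (fst (h n)) (snd (h n)))))
            \<in> measurable (PiM {0..<Suc n} ?M) (subprob_algebra (count_space UNIV))"
      by (rule measurable_compose[rotated])
    moreover have "trajectory_kernel T p s (Suc n) =
        (\<lambda>h. measure_pmf (state_action_pmf p (T (fst (h n)) (snd (h n)))))"
      by (rule ext) simp
    ultimately show ?thesis
      using Suc by (simp del: trajectory_kernel.simps)
  qed
next
  fix i :: nat and h :: "nat \<Rightarrow> 's \<times> 'a"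
  show "prob_space (trajectory_kernel T p s i h)"
    by (cases i) (simp_all add: measure_pmf.prob_space_axioms)
qed

text \<open>
  Since \<open>ln 0 = 0\<close>, an action of probability zero contributes no entropy penalty; such
  actions are almost surely not taken.
\<close>

definition policy_value ::
  "('s \<Rightarrow> 'a \<Rightarrow> 's pmf) \<Rightarrow> real \<Rightarrow> real \<Rightarrow> ('s \<Rightarrow> 'a \<Rightarrow> real) \<Rightarrow> ('s \<Rightarrow> 'a pmf) \<Rightarrow> 's \<Rightarrow> real"
where
  "policy_value T \<gamma> lam f p s =
     (\<integral>\<omega>. (\<Sum>t. \<gamma> ^ t * (f (fst (\<omega> t)) (snd (\<omega> t))
                        - lam * ln (pmf (p (fst (\<omega> t))) (snd (\<omega> t)))))
       \<partial>trajectory_measure T p s)"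

definition optimal_value ::
  "('s \<Rightarrow> 'a \<Rightarrow> 's pmf) \<Rightarrow> real \<Rightarrow> real \<Rightarrow> ('s \<Rightarrow> 'a \<Rightarrow> real) \<Rightarrow> 's \<Rightarrow> real"
where
  "optimal_value T \<gamma> lam f s = (SUP p. policy_value T \<gamma> lam f p s)"

definition is_optimal_policy ::
  "('s \<Rightarrow> 'a \<Rightarrow> 's pmf) \<Rightarrow> real \<Rightarrow> real \<Rightarrow> ('s \<Rightarrow> 'a \<Rightarrow> real) \<Rightarrow> ('s \<Rightarrow> 'a pmf) \<Rightarrow> bool"
where
  "is_optimal_policy T \<gamma> lam f p \<longleftrightarrow>
     (\<forall>s. policy_value T \<gamma> lam f p s = optimal_value T \<gamma> lam f s)"

text \<open>
  A reward \<open>f :: 's \<Rightarrow> real\<close> is read as the action-independent reward \<open>\<lambda>s a. f s\<close>.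
  Inferring it from \<open>p\<close> up to a constant shift means that any two such rewards for which
  \<open>p\<close> is optimal differ by a constant.
\<close>

definition action_independent_irl_identifiable ::
  "('s \<Rightarrow> 'a \<Rightarrow> 's pmf) \<Rightarrow> real \<Rightarrow> real \<Rightarrow> ('s \<Rightarrow> 'a pmf) \<Rightarrow> bool"
where
  "action_independent_irl_identifiable T \<gamma> lam p \<longleftrightarrow>
     (\<forall>f f' :: 's \<Rightarrow> real.
        is_optimal_policy T \<gamma> lam (\<lambda>s a. f s) p \<and> is_optimal_policy T \<gamma> lam (\<lambda>s a. f' s) p
        \<longrightarrow> (\<exists>c. \<forall>s. f' s = f s + c))"

end

theory Submission
  imports Defs
begin

text \<open>
  A policy \<open>p\<close> is optimal for \<open>f\<close> exactly if
  \<open>lam * ln (p a|s) = f s + \<gamma> * E[V | s, a] - V s\<close> for some \<open>V\<close>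
  (necessarily the optimal value). Subtracting this for two rewards with the same optimal policy,
  the difference \<open>W\<close> of the values satisfies: \<open>E[W | s, a]\<close> does not depend
  on \<open>a\<close>. Conversely every such \<open>W\<close> yields a new reward
  \<open>f s + W s - \<gamma> * E[W | s, a]\<close> with the same optimal policy, and it differs from
  \<open>f\<close> by a constant iff \<open>W\<close> is constant. Under either structural assumption
  the independence of \<open>a\<close> says that \<open>W\<close> is constant on the possible
  successors of each state, that is, on each class of linked states; states without a
  predecessor are unconstrained.
\<close>

subsection \<open>Policy evaluation\<close>

definition policy_avg :: "('s \<Rightarrow> 'a pmf) \<Rightarrow> ('s \<Rightarrow> 'a \<Rightarrow> real) \<Rightarrow> 's \<Rightarrow> real" where
  "policy_avg p h s = (\<Sum>a\<in>UNIV. pmf (p s) a * h s a)"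

definition next_value :: "('s \<Rightarrow> 'a \<Rightarrow> 's pmf) \<Rightarrow> ('s \<Rightarrow> real) \<Rightarrow> 's \<Rightarrow> 'a \<Rightarrow> real" where
  "next_value T V s a = (\<Sum>s'\<in>UNIV. pmf (T s a) s' * V s')"

lemma sum_pmf_UNIV [simp]: "(\<Sum>x\<in>UNIV. pmf p x) = 1" for p :: "'b::finite pmf"
  by (rule sum_pmf_eq_1) auto

lemma integral_state_action_pmf:
  fixes p :: "'s::finite \<Rightarrow> 'a::finite pmf"
  shows "(\<integral>x. g x \<partial>measure_pmf (state_action_pmf p D)) =
    (\<Sum>s\<in>UNIV. pmf D s * policy_avg p (\<lambda>s a. g (s, a)) s)"
proof -
  have "(\<integral>x. g x \<partial>measure_pmf (state_action_pmf p D)) =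
      (\<Sum>s\<in>UNIV. pmf D s *\<^sub>R (\<integral>x. g x \<partial>measure_pmf (map_pmf (\<lambda>a. (s, a)) (p s))))"
    unfolding state_action_pmf_def by (rule pmf_expectation_bind) auto
  also have "\<dots> = (\<Sum>s\<in>UNIV. pmf D s * policy_avg p (\<lambda>s a. g (s, a)) s)"
    by (simp add: policy_avg_def integral_measure_pmf[of UNIV])
  finally show ?thesis .
qed

lemma abs_weighted_sum_le:
  fixes q :: "'b::finite pmf"
  assumes "\<And>x. \<bar>h x\<bar> \<le> B"
  shows "\<bar>\<Sum>x\<in>UNIV. pmf q x * h x\<bar> \<le> B"
proof -
  have "\<bar>\<Sum>x\<in>UNIV. pmf q x * h x\<bar> \<le> (\<Sum>x\<in>UNIV. pmf q x * B)"
    by (rule order.trans[OF sum_abs]) (auto simp: abs_mult intro!: sum_mono mult_left_mono assms)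
  then show ?thesis by (simp flip: sum_distrib_right)
qed

lemma weighted_sum_le:
  fixes q :: "'b::finite pmf"
  assumes "\<And>x. h x \<le> (B::real)"
  shows "(\<Sum>x\<in>UNIV. pmf q x * h x) \<le> B"
proof -
  have "(\<Sum>x\<in>UNIV. pmf q x * h x) \<le> (\<Sum>x\<in>UNIV. pmf q x * B)"
    by (auto intro!: sum_mono mult_left_mono assms)
  then show ?thesis by (simp flip: sum_distrib_right)
qed

text \<open>
  One step of the backward recursion for the state-action chain:
  \<open>E[g (S\<^sub>n\<^sub>+\<^sub>1, A\<^sub>n\<^sub>+\<^sub>1)] = E[step_backward T p g (S\<^sub>n, A\<^sub>n)]\<close>.
\<close>

definition step_backward ::
  "('s \<Rightarrow> 'a \<Rightarrow> 's pmf) \<Rightarrow> ('s \<Rightarrow> 'a pmf) \<Rightarrow> ('s \<Rightarrow> 'a \<Rightarrow> real) \<Rightarrow> 's \<Rightarrow> 'a \<Rightarrow> real"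
where
  "step_backward T p g = next_value T (policy_avg p g)"

lemma finite_abs_bounded:
  fixes g :: "'b::finite \<Rightarrow> real"
  obtains B where "\<And>x. \<bar>g x\<bar> \<le> B"
proof
  show "\<bar>g x\<bar> \<le> Max (range (\<lambda>x. \<bar>g x\<bar>))" for x
    by (rule Max_ge) auto
qed

section \<open>Finite-time marginals of the state-action process\<close>

context
  fixes T :: "'s::finite \<Rightarrow> 'a::finite \<Rightarrow> 's pmf" and p :: "'s \<Rightarrow> 'a pmf" and s :: 's
begin

interpretation IT: Ionescu_Tulcea "trajectory_kernel T p s" "\<lambda>_. count_space UNIV"
  by (rule Ionescu_Tulcea_trajectory_kernel)

text \<open>The law of coordinates \<open>0\<close> to \<open>n - 1\<close>; the
  \<open>undefined\<close> function is the only point of the empty product, that is, the empty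
  history.\<close>

abbreviation (input) "hist n \<equiv> IT.C 0 n (\<lambda>_. undefined)"

lemma undefined_in_space: "(\<lambda>_. undefined) \<in> space (PiM {0..<0::nat} (\<lambda>_. count_space UNIV))"
  by (simp add: space_PiM)

text \<open>Tower property for the newest coordinate. Finiteness makes \<open>g\<close> bounded,
  which justifies integrating in two stages.\<close>

lemma integral_history_Suc:
  "(\<integral>\<omega>. g (\<omega> n) \<partial>hist (Suc n)) =
   (\<integral>\<omega>. (\<integral>x. g x \<partial>trajectory_kernel T p s n \<omega>) \<partial>hist n)" for g :: "'s \<times> 'a \<Rightarrow> real"
proof -
  let ?M = "\<lambda>_::nat. count_space (UNIV :: ('s \<times> 'a) set)"
  obtain B where B: "\<And>x. \<bar>g x\<bar> \<le> B" using finite_abs_bounded by blast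
  have space: "space (hist n) = space (PiM {0..<n} ?M)"
    using IT.space_C[OF undefined_in_space] by simp
  have g [measurable]: "(\<lambda>\<omega>. g (\<omega> n)) \<in> borel_measurable (PiM {0..<Suc n} ?M)"
    by (rule measurable_compose[OF measurable_component_singleton]) auto
  have "(\<integral>\<omega>. g (\<omega> n) \<partial>hist (Suc n)) = (\<integral>\<omega>. (\<integral>x. g (x n) \<partial>IT.eP n \<omega>) \<partial>hist n)"
    unfolding IT.C.simps add_0
  proof (rule integral_bind[where B = B and B' = 1, OF g])
    show "IT.eP n \<in> hist n \<rightarrow>\<^sub>M subprob_algebra (PiM {0..<Suc n} ?M)"
      using IT.measurable_eP[of n] IT.sets_C[OF undefined_in_space, of n]
      by (simp cong: measurable_cong_sets)
    show "finite_measure (hist n)"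
      using IT.prob_space_C[OF undefined_in_space, of n]
      by (simp add: prob_space.finite_measure)
    show "AE \<omega> in hist n. emeasure (IT.eP n \<omega>) (space (IT.eP n \<omega>)) \<le> ennreal 1"
      using prob_space.emeasure_space_1[OF IT.prob_space_eP[of _ n]]
      by (intro AE_I2) (simp add: space)
  qed (rule B)
  also have "\<dots> = (\<integral>\<omega>. (\<integral>x. g x \<partial>trajectory_kernel T p s n \<omega>) \<partial>hist n)"
  proof (rule Bochner_Integration.integral_cong[OF refl])
    fix \<omega> assume "\<omega> \<in> space (hist n)"
    then have \<omega>: "\<omega> \<in> space (PiM {0..<n} ?M)" by (simp add: space)
    have "fun_upd \<omega> n \<in> trajectory_kernel T p s n \<omega> \<rightarrow>\<^sub>M PiM {0..<Suc n} ?M"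
      using \<omega> by (intro measurable_fun_upd[where J="{0..<n}"])
        (auto simp: IT.sets_P cong: measurable_cong_sets)
    then show "(\<integral>x. g (x n) \<partial>IT.eP n \<omega>) = (\<integral>x. g x \<partial>trajectory_kernel T p s n \<omega>)"
      unfolding IT.eP_def by (subst integral_distr) auto
  qed
  finally show ?thesis .
qed

text \<open>Transitions are integrated out from the end, each replacing \<open>g\<close> by a
  function of the preceding pair; hence the induction over all \<open>g\<close>.\<close>

lemma integral_history:
  "(\<integral>\<omega>. g (fst (\<omega> n)) (snd (\<omega> n)) \<partial>hist (Suc n)) = policy_avg p ((step_backward T p ^^ n) g) s"
proof (induction n arbitrary: g)
  case 0
  have "(\<integral>\<omega>. g (fst (\<omega> 0)) (snd (\<omega> 0)) \<partial>hist (Suc 0)) =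
      (\<integral>x. g (fst x) (snd x) \<partial>measure_pmf (state_action_pmf p (return_pmf s)))"
    by (subst integral_history_Suc[where g = "\<lambda>x. g (fst x) (snd x)"])
       (simp add: space_PiM measure_return sets_PiM_empty)
  then show ?case
    by (simp add: integral_state_action_pmf indicator_def if_distrib if_distribR cong: if_cong)
next
  case (Suc n)
  have "(\<integral>\<omega>. g (fst (\<omega> (Suc n))) (snd (\<omega> (Suc n))) \<partial>hist (Suc (Suc n))) =
      (\<integral>\<omega>. step_backward T p g (fst (\<omega> n)) (snd (\<omega> n)) \<partial>hist (Suc n))"
    by (subst integral_history_Suc[where g = "\<lambda>x. g (fst x) (snd x)"])
       (simp add: integral_state_action_pmf step_backward_def next_value_def)
  also have "\<dots> = policy_avg p ((step_backward T p ^^ Suc n) g) s"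
    using Suc.IH[of "step_backward T p g"] by (simp add: funpow_swap1)
  finally show ?case .
qed

lemma sets_trajectory_measure:
  "sets (trajectory_measure T p s) = sets (PiM UNIV (\<lambda>_. count_space UNIV))"
  unfolding trajectory_measure_def by (rule IT.PF.sets_lim)

text \<open>A pushforward preserves total mass, so one marginal suffices; the empty set of
  coordinates is the simplest.\<close>

lemma prob_space_trajectory: "prob_space (trajectory_measure T p s)"
proof (rule prob_space_distrD)
  let ?M = "\<lambda>_::nat. count_space (UNIV :: ('s \<times> 'a) set)"
  show "(\<lambda>\<omega>. restrict \<omega> {}) \<in> trajectory_measure T p s \<rightarrow>\<^sub>M PiM {} ?M"
    unfolding trajectory_measure_def
    by (auto intro!: measurable_restrict_subset cong: measurable_cong_sets)
  show "prob_space (distr (trajectory_measure T p s) (PiM {} ?M) (\<lambda>\<omega>. restrict \<omega> {}))"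
    unfolding trajectory_measure_def by (simp add: IT.distr_lim IT.PF.prob_space_P)
qed

lemma integral_trajectory_nth:
  "(\<integral>\<omega>. g (fst (\<omega> n)) (snd (\<omega> n)) \<partial>trajectory_measure T p s) =
   policy_avg p ((step_backward T p ^^ n) g) s"
proof -
  let ?M = "\<lambda>_::nat. count_space (UNIV :: ('s \<times> 'a) set)" and ?J = "{0..<Suc n}"
  have g [measurable]: "(\<lambda>\<omega>. g (fst (\<omega> n)) (snd (\<omega> n))) \<in> borel_measurable (PiM ?J ?M)"
    by (rule measurable_compose[OF measurable_component_singleton]) auto
  \<comment> \<open>\<open>IT.up_to ?J\<close> is the length of the shortest history covering
    \<open>?J\<close>; as indices start at \<open>0\<close>, this is \<open>Suc n\<close>.\<close>
  have "IT.up_to ?J \<le> k \<longleftrightarrow> Suc n \<le> k" for k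
    by (simp add: IT.up_to_iff_Ico )
  then have up_to: "IT.up_to ?J = Suc n"
    by (meson order.antisym order.refl)
  have "(\<integral>\<omega>. g (fst (\<omega> n)) (snd (\<omega> n)) \<partial>trajectory_measure T p s) =
      (\<integral>\<omega>. g (fst (\<omega> n)) (snd (\<omega> n))
         \<partial>distr (trajectory_measure T p s) (PiM ?J ?M) (\<lambda>\<omega>. restrict \<omega> ?J))"
    by (subst integral_distr)
      (auto simp: trajectory_measure_def IT.PF.sets_lim intro!: measurable_restrict_subset cong: measurable_cong_sets)
  also have "\<dots> = (\<integral>\<omega>. g (fst (\<omega> n)) (snd (\<omega> n)) \<partial>IT.CI ?J)"
    unfolding trajectory_measure_def by (simp add: IT.distr_lim)
  also have "\<dots> = (\<integral>\<omega>. g (fst (\<omega> n)) (snd (\<omega> n)) \<partial>hist (Suc n))"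
    unfolding IT.CI_def up_to
    by (subst integral_distr)
      (auto simp: IT.sets_C[OF undefined_in_space] simp del: IT.C.simps intro!: measurable_restrict_subset cong: measurable_cong_sets)
  finally show ?thesis
    by (simp only: integral_history)
qed

end

section \<open>Discounted series and policy evaluation\<close>

definition soft_reward ::
  "real \<Rightarrow> ('s \<Rightarrow> 'a \<Rightarrow> real) \<Rightarrow> ('s \<Rightarrow> 'a pmf) \<Rightarrow> 's \<Rightarrow> 'a \<Rightarrow> real" where
  "soft_reward lam f p s a = f s a - lam * ln (pmf (p s) a)"

text \<open>Averaging cannot increase the sup norm, so one bound serves all times and a geometric
  series dominates.\<close>

lemma step_backward_abs_le:
  fixes T :: "'s::finite \<Rightarrow> 'a::finite \<Rightarrow> 's pmf"
  assumes "\<And>s a. \<bar>g s a\<bar> \<le> B"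
  shows "\<bar>(step_backward T p ^^ n) g s a\<bar> \<le> B"
  using assms
  by (induction n arbitrary: s a)
    (auto simp: step_backward_def next_value_def policy_avg_def intro!: abs_weighted_sum_le)

lemma summable_discounted_bounded:
  fixes x :: "nat \<Rightarrow> real"
  assumes "0 < \<gamma>" "\<gamma> < 1" and "\<And>n. \<bar>x n\<bar> \<le> B"
  shows "summable (\<lambda>n. \<gamma> ^ n * x n)"
proof (rule summable_comparison_test')
  show "summable (\<lambda>n. B * \<gamma> ^ n)"
    using assms(1,2) by (intro summable_mult summable_geometric) auto
  show "norm (\<gamma> ^ n * x n) \<le> B * \<gamma> ^ n" if "0 \<le> n" for n
    using assms by (simp add: abs_mult mult.commute mult_right_mono)
qed

text \<open>The residual of \<open>V\<close> in the policy evaluation equation of \<open>p\<close>;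
  a uniform sign places the value of \<open>p\<close> above or below \<open>V\<close>.\<close>

definition advantage ::
  "('s::finite \<Rightarrow> 'a::finite \<Rightarrow> 's pmf) \<Rightarrow> real \<Rightarrow> real \<Rightarrow> ('s \<Rightarrow> 'a \<Rightarrow> real) \<Rightarrow> ('s \<Rightarrow> 'a pmf) \<Rightarrow>
    ('s \<Rightarrow> real) \<Rightarrow> 's \<Rightarrow> real" where
  "advantage T \<gamma> lam f p V s =
    policy_avg p (\<lambda>s a. soft_reward lam f p s a + \<gamma> * next_value T V s a) s - V s"

context
  fixes T :: "'s::finite \<Rightarrow> 'a::finite \<Rightarrow> 's pmf" and \<gamma> :: real
  assumes \<gamma>: "0 < \<gamma>" "\<gamma> < 1"
begin

lemma integral_discounted_trajectory:
  "(\<integral>\<omega>. (\<Sum>t. \<gamma> ^ t * g (fst (\<omega> t)) (snd (\<omega> t))) \<partial>trajectory_measure T p s) =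
   (\<Sum>t. \<gamma> ^ t * policy_avg p ((step_backward T p ^^ t) g) s)"
proof -
  let ?P = "trajectory_measure T p s"
  interpret prob_space ?P by (rule prob_space_trajectory)
  obtain B where "\<And>x. \<bar>case_prod g x\<bar> \<le> B" using finite_abs_bounded by blast
  then have B: "\<bar>g s a\<bar> \<le> B" for s a by (metis case_prod_conv)
  have "(\<lambda>\<omega>. g (fst (\<omega> n)) (snd (\<omega> n))) \<in> borel_measurable ?P" for n
    unfolding measurable_cong_sets[OF sets_trajectory_measure refl]
    by (rule measurable_compose[OF measurable_component_singleton]) auto
  then have int: "integrable ?P (\<lambda>\<omega>. \<gamma> ^ n * g (fst (\<omega> n)) (snd (\<omega> n)))" for n
    by (intro integrable_mult_right integrable_const_bound[where B = B]) (auto simp: B)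
  have "(\<integral>\<omega>. (\<Sum>t. \<gamma> ^ t * g (fst (\<omega> t)) (snd (\<omega> t))) \<partial>?P) =
      (\<Sum>t. \<integral>\<omega>. \<gamma> ^ t * g (fst (\<omega> t)) (snd (\<omega> t)) \<partial>?P)"
  proof (rule integral_suminf[OF int])
    show "AE \<omega> in ?P. summable (\<lambda>t. norm (\<gamma> ^ t * g (fst (\<omega> t)) (snd (\<omega> t))))"
      using \<gamma> summable_discounted_bounded[OF \<gamma>, of "\<lambda>t. \<bar>g (fst (\<omega> t)) (snd (\<omega> t))\<bar>" B for \<omega>]
      by (simp add: B abs_mult)
    have "\<bar>\<integral>\<omega>. \<bar>g (fst (\<omega> t)) (snd (\<omega> t))\<bar> \<partial>?P\<bar> \<le> B" for t
    proof -
      have "\<bar>policy_avg p ((step_backward T p ^^ t) (\<lambda>s a. \<bar>g s a\<bar>)) s\<bar> \<le> B"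
        unfolding policy_avg_def
        by (intro abs_weighted_sum_le step_backward_abs_le) (simp add: B)
      then show ?thesis
        by (simp add: integral_trajectory_nth[where g = "\<lambda>s a. \<bar>g s a\<bar>"])
    qed
    then show "summable (\<lambda>t. \<integral>\<omega>. norm (\<gamma> ^ t * g (fst (\<omega> t)) (snd (\<omega> t))) \<partial>?P)"
      using summable_discounted_bounded[OF \<gamma>, of "\<lambda>t. \<integral>\<omega>. \<bar>g (fst (\<omega> t)) (snd (\<omega> t))\<bar> \<partial>?P" B] \<gamma>
      by (simp add: abs_mult)
  qed
  then show ?thesis
    by (simp add: integral_trajectory_nth)
qed

text \<open>Time \<open>0\<close> is split off from the value series; the remaining terms form a
  discounted value series of the successors.\<close>

lemma policy_value_eq:
  "policy_value T \<gamma> lam f p s =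
   policy_avg p (\<lambda>s a. soft_reward lam f p s a + \<gamma> * next_value T (policy_value T \<gamma> lam f p) s a) s"
proof -
  define v where "v n = policy_avg p ((step_backward T p ^^ n) (soft_reward lam f p))" for n
  let ?V = "policy_value T \<gamma> lam f p"
  have V: "?V s = (\<Sum>n. \<gamma> ^ n * v n s)" for s
    unfolding policy_value_def v_def
    by (subst integral_discounted_trajectory[symmetric]) (simp add: soft_reward_def)
  obtain B where "\<And>x. \<bar>case_prod (soft_reward lam f p) x\<bar> \<le> B" using finite_abs_bounded by blast
  then have B: "\<bar>soft_reward lam f p s a\<bar> \<le> B" for s a by (metis case_prod_conv)
  have "\<bar>v n s\<bar> \<le> B" for n s
    unfolding v_def policy_avg_def by (intro abs_weighted_sum_le step_backward_abs_le B)
  then have sum: "summable (\<lambda>n. \<gamma> ^ n * v n s)" for s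
    by (rule summable_discounted_bounded[OF \<gamma>])
  have next_sums: "(\<lambda>n. \<gamma> ^ n * next_value T (v n) s a) sums next_value T ?V s a" for s a
  proof -
    have "(\<lambda>n. \<Sum>s'\<in>UNIV. pmf (T s a) s' * (\<gamma> ^ n * v n s')) sums (\<Sum>s'\<in>UNIV. pmf (T s a) s' * ?V s')"
      by (intro sums_sum sums_mult) (simp add: V summable_sums[OF sum])
    then show ?thesis
      by (simp add: next_value_def sum_distrib_left mult.left_commute)
  qed
  have "(\<lambda>n. \<Sum>a\<in>UNIV. pmf (p s) a * (\<gamma> ^ n * next_value T (v n) s a)) sums
      (\<Sum>a\<in>UNIV. pmf (p s) a * next_value T ?V s a)"
    by (intro sums_sum sums_mult next_sums)
  \<comment> \<open>\<open>v (Suc n)\<close> is \<open>policy_avg p (next_value T (v n))\<close>, so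
    this is the tail of the value series with one discount factor missing.\<close>
  then have "(\<lambda>n. \<gamma> ^ n * v (Suc n) s) sums policy_avg p (next_value T ?V) s"
    by (simp add: v_def policy_avg_def step_backward_def sum_distrib_left mult.left_commute)
  then have "(\<lambda>n. \<gamma> ^ Suc n * v (Suc n) s) sums (\<gamma> * policy_avg p (next_value T ?V) s)"
    using sums_mult[of _ _ \<gamma>] by (simp add: mult.assoc)
  then have "(\<lambda>n. \<gamma> ^ n * v n s) sums (\<gamma> * policy_avg p (next_value T ?V) s + v 0 s)"
    by (subst (asm) sums_Suc_iff) simp
  then show ?thesis
    by (simp add: V[of s] sums_iff v_def policy_avg_def sum.distrib distrib_left sum_distrib_left
        mult.left_commute)
qed

text \<open>Evaluate the hypothesis at a maximiser of \<open>U\<close>.\<close>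

lemma discounted_max_principle:
  fixes U :: "'s \<Rightarrow> real"
  assumes "\<And>s. U s \<le> c + \<gamma> * policy_avg p (next_value T U) s"
  shows "U s \<le> c / (1 - \<gamma>)"
proof -
  define m where "m = Max (range U)"
  have le: "U s \<le> m" for s by (simp add: m_def)
  have "m \<in> range U" unfolding m_def by (rule Max_in) auto
  then obtain s0 where "m = U s0" by auto
  moreover have "policy_avg p (next_value T U) s0 \<le> m"
    unfolding policy_avg_def next_value_def by (intro weighted_sum_le le)
  ultimately have "m \<le> c + \<gamma> * m"
    using assms[of s0] \<gamma> by (smt (verit) mult_left_mono)
  then have "m \<le> c / (1 - \<gamma>)"
    using \<gamma> by (simp add: pos_le_divide_eq algebra_simps)
  with le show ?thesis by (meson order.trans)
qed

text \<open>Performance difference identity: subtracting \<open>V\<close> from the evaluation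
  equation leaves the same recursion, with the residual as reward.\<close>

lemma policy_value_diff:
  "policy_value T \<gamma> lam f p s - V s =
   advantage T \<gamma> lam f p V s +
   \<gamma> * policy_avg p (next_value T (\<lambda>s. policy_value T \<gamma> lam f p s - V s)) s"
  by (subst policy_value_eq)
    (simp add: advantage_def policy_avg_def next_value_def algebra_simps sum_distrib_left
      sum.distrib sum_subtractf)

lemma policy_value_le:
  assumes "\<And>s. advantage T \<gamma> lam f p V s \<le> c"
  shows "policy_value T \<gamma> lam f p s - V s \<le> c / (1 - \<gamma>)"
proof (rule discounted_max_principle[where p = p])
  fix s
  show "policy_value T \<gamma> lam f p s - V s \<le>
      c + \<gamma> * policy_avg p (next_value T (\<lambda>s. policy_value T \<gamma> lam f p s - V s)) s"
    by (subst policy_value_diff) (use assms[of s] in simp)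
qed

text \<open>The maximum principle first gives nonnegativity of the difference; inserted into the
  difference identity, this retains the advantage at \<open>s\<close> itself. Policy improvement
  rests on that pointwise gain.\<close>

lemma policy_value_ge:
  assumes "\<And>s. advantage T \<gamma> lam f p V s \<ge> 0"
  shows "policy_value T \<gamma> lam f p s - V s \<ge> advantage T \<gamma> lam f p V s"
proof -
  have neg: "policy_avg p (next_value T (\<lambda>s. - U s)) s = - policy_avg p (next_value T U) s" for U s
    by (simp add: policy_avg_def next_value_def sum_negf)
  let ?U = "\<lambda>s. policy_value T \<gamma> lam f p s - V s"
  have "- ?U s \<le> 0 + \<gamma> * policy_avg p (next_value T (\<lambda>s. - ?U s)) s" for s
    unfolding neg using policy_value_diff[of lam f p s V] assms[of s] by simp
  from discounted_max_principle[OF this] have U: "- ?U s \<le> 0" for s by simp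
  have "policy_avg p (next_value T (\<lambda>s. - ?U s)) s \<le> 0"
    unfolding policy_avg_def next_value_def by (intro weighted_sum_le U)
  then have "policy_avg p (next_value T ?U) s \<ge> 0"
    unfolding neg by simp
  with \<gamma> show ?thesis
    using policy_value_diff[of lam f p s V] by simp
qed

end

subsection \<open>Characterisation of optimal policies\<close>

text \<open>For \<open>x > 0\<close> this is \<open>ln u \<le> u - 1\<close> at
  \<open>u = y / x\<close>, scaled by \<open>x\<close>. At \<open>x = 0\<close> the left side
  vanishes and \<open>0 < y\<close> excludes equality.\<close>

lemma gibbs_term:
  fixes x y :: real
  assumes "0 \<le> x" "0 < y"
  shows gibbs_term_le: "x * (ln y - ln x) \<le> y - x"
    and gibbs_term_eqD: "x * (ln y - ln x) = y - x \<Longrightarrow> x = y"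
proof -
  have "x * (ln y - ln x) \<le> y - x \<and> (x * (ln y - ln x) = y - x \<longrightarrow> x = y)"
  proof (cases "x = 0")
    case False
    then have x: "x > 0" using assms by simp
    have eq: "ln y - ln x = ln (y / x)" and eq': "y - x = x * (y / x - 1)"
      using x assms by (simp_all add: ln_div field_simps)
    have "ln (y / x) \<le> y / x - 1"
      using x assms by (intro ln_le_minus_one) auto
    moreover have "y / x = 1" if "ln (y / x) = y / x - 1"
      using that x assms by (intro ln_eq_minus_one) auto
    ultimately show ?thesis
      unfolding eq eq' using x by (auto simp: mult_left_mono)
  qed (use assms in auto)
  then show "x * (ln y - ln x) \<le> y - x" "x * (ln y - ln x) = y - x \<Longrightarrow> x = y" by auto
qed

text \<open>The sum is minus the relative entropy of \<open>p\<close> with respect to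
  \<open>q\<close>. The termwise bounds add up to \<open>1 - 1 = 0\<close>, so a zero sum forces
  equality in each term.\<close>

lemma gibbs_inequality:
  fixes p q :: "'a::finite pmf"
  assumes q: "\<And>a. pmf q a > 0"
  shows gibbs_le: "(\<Sum>a\<in>UNIV. pmf p a * (ln (pmf q a) - ln (pmf p a))) \<le> 0"
    and gibbs_eqD: "(\<Sum>a\<in>UNIV. pmf p a * (ln (pmf q a) - ln (pmf p a))) = 0 \<Longrightarrow> p = q"
proof -
  have le: "pmf p a * (ln (pmf q a) - ln (pmf p a)) \<le> pmf q a - pmf p a" for a
    by (rule gibbs_term_le[OF pmf_nonneg q])
  have diff: "(\<Sum>a\<in>UNIV. pmf q a - pmf p a) = 0"
    by (simp add: sum_subtractf)
  have "(\<Sum>a\<in>UNIV. pmf p a * (ln (pmf q a) - ln (pmf p a))) \<le> (\<Sum>a\<in>UNIV. pmf q a - pmf p a)"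
    by (intro sum_mono le)
  then show "(\<Sum>a\<in>UNIV. pmf p a * (ln (pmf q a) - ln (pmf p a))) \<le> 0"
    by (simp only: diff)
  assume "(\<Sum>a\<in>UNIV. pmf p a * (ln (pmf q a) - ln (pmf p a))) = 0"
  then have eq: "(\<Sum>a\<in>UNIV. pmf p a * (ln (pmf q a) - ln (pmf p a))) = (\<Sum>a\<in>UNIV. pmf q a - pmf p a)"
    unfolding diff .
  have "pmf p a * (ln (pmf q a) - ln (pmf p a)) = pmf q a - pmf p a" for a
    by (rule sum_mono_inv[OF eq le]) auto
  then have "pmf p a = pmf q a" for a
    by (rule gibbs_term_eqD[OF pmf_nonneg q])
  then show "p = q" by (rule pmf_eqI)
qed

text \<open>\<open>q\<close> is the Boltzmann distribution of \<open>h\<close> at temperature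
  \<open>lam\<close>, and \<open>L\<close> is \<open>lam\<close> times its log-partition
  function.\<close>

lemma softmax_exists:
  fixes h :: "'s \<Rightarrow> 'a::finite \<Rightarrow> real"
  assumes lam: "lam > 0"
  obtains q :: "'s \<Rightarrow> 'a pmf" and L
  where "\<And>s a. pmf (q s) a > 0" and "\<And>s a. h s a = lam * ln (pmf (q s) a) + L s"
proof
  define Z where "Z s = (\<Sum>a\<in>UNIV. exp (h s a / lam))" for s
  have Z: "Z s > 0" for s unfolding Z_def by (intro sum_pos) auto
  define q where "q s = embed_pmf (\<lambda>a. exp (h s a / lam) / Z s)" for s
  have "(\<Sum>a\<in>UNIV. exp (h s a / lam) / Z s) = 1" for s
    using Z[of s] by (simp add: sum_divide_distrib[symmetric] Z_def[symmetric])
  then have q: "pmf (q s) a = exp (h s a / lam) / Z s" for s a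
    unfolding q_def using Z[of s]
    by (intro pmf_embed_pmf) (auto simp: nn_integral_count_space_finite less_imp_le)
  show "pmf (q s) a > 0" for s a
    by (simp add: q Z)
  show "h s a = lam * ln (pmf (q s) a) + lam * ln (Z s)" for s a
    using Z[of s] lam by (simp add: q ln_div right_diff_distrib)
qed

text \<open>For positive \<open>q\<close> the advantage is \<open>L s - V s\<close> minus
  \<open>lam\<close> times the relative entropy of \<open>p s\<close> with respect to
  \<open>q s\<close>; for \<open>lam > 0\<close> the choice \<open>p = q\<close> is therefore
  best.\<close>

lemma advantage_eq:
  assumes "\<And>s a. f s a + \<gamma> * next_value T V s a = lam * ln (pmf (q s) a) + L s"
  shows "advantage T \<gamma> lam f p V s =
    lam * (\<Sum>a\<in>UNIV. pmf (p s) a * (ln (pmf (q s) a) - ln (pmf (p s) a))) + L s - V s"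
proof -
  have "soft_reward lam f p s a + \<gamma> * next_value T V s a =
      lam * (ln (pmf (q s) a) - ln (pmf (p s) a)) + L s" for a
    using assms[of s a] by (simp add: soft_reward_def algebra_simps)
  then show ?thesis
    by (simp add: advantage_def policy_avg_def distrib_left sum.distrib sum_distrib_left
        mult.left_commute flip: sum_distrib_right)
qed

text \<open>Makes the real-valued \<open>SUP\<close> in \<open>optimal_value\<close> an upper bound.
  Against \<open>V = 0\<close> the advantage is at most the soft maximum \<open>L\<close> of
  \<open>f\<close>, whatever \<open>p\<close> is.\<close>

lemma bdd_above_policy_value:
  fixes T :: "'s::finite \<Rightarrow> 'a::finite \<Rightarrow> 's pmf"
  assumes \<gamma>: "0 < \<gamma>" "\<gamma> < 1" and lam: "lam > 0"
  shows "bdd_above (range (\<lambda>p. policy_value T \<gamma> lam f p s))"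
proof -
  obtain q :: "'s \<Rightarrow> 'a pmf" and L where q: "\<And>s a. pmf (q s) a > 0"
    and L: "\<And>s a. f s a = lam * ln (pmf (q s) a) + L s"
    by (rule softmax_exists[OF lam, of f]) blast
  obtain c where c: "\<And>s. \<bar>L s\<bar> \<le> c" using finite_abs_bounded by blast
  have adv: "advantage T \<gamma> lam f p (\<lambda>_. 0) s \<le> c" for p s
  proof -
    have "advantage T \<gamma> lam f p (\<lambda>_. 0) s =
        lam * (\<Sum>a\<in>UNIV. pmf (p s) a * (ln (pmf (q s) a) - ln (pmf (p s) a))) + L s - 0"
      by (rule advantage_eq) (simp add: L next_value_def)
    also have "\<dots> \<le> c"
      using gibbs_le[OF q[of s], of "p s"] lam c[of s] by (smt (verit) mult_nonneg_nonpos)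
    finally show ?thesis .
  qed
  have "policy_value T \<gamma> lam f p s - 0 \<le> c / (1 - \<gamma>)" for p
    using policy_value_le[OF \<gamma>, where V = "\<lambda>_. 0", OF adv] .
  then show ?thesis by (intro bdd_aboveI) auto
qed

text \<open>
  The forward direction is a policy improvement argument: the softmax policy for the value
  of an optimal \<open>p\<close> is at least as good as \<open>p\<close>, and strictly better
  wherever it differs from it. This avoids the existence of a fixed point of the soft Bellman
  operator.
\<close>

lemma is_optimal_policy_iff:
  fixes T :: "'s::finite \<Rightarrow> 'a::finite \<Rightarrow> 's pmf"
  assumes \<gamma>: "0 < \<gamma>" "\<gamma> < 1" and lam: "lam > 0"
  shows "is_optimal_policy T \<gamma> lam f p \<longleftrightarrow>
    (\<exists>V. \<forall>s a. pmf (p s) a > 0 \<and> f s a + \<gamma> * next_value T V s a = lam * ln (pmf (p s) a) + V s)"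
proof
  assume opt: "is_optimal_policy T \<gamma> lam f p"
  define V where "V = policy_value T \<gamma> lam f p"
  obtain q :: "'s \<Rightarrow> 'a pmf" and L where q: "\<And>s a. pmf (q s) a > 0"
    and L: "\<And>s a. f s a + \<gamma> * next_value T V s a = lam * ln (pmf (q s) a) + L s"
    by (rule softmax_exists[OF lam, of "\<lambda>s a. f s a + \<gamma> * next_value T V s a"]) blast
  \<comment> \<open>Against its own value \<open>p\<close> has advantage \<open>0\<close>, so
    \<open>L s - V s\<close> is \<open>lam\<close> times a relative entropy.\<close>
  have adv_p: "lam * (\<Sum>a\<in>UNIV. pmf (p s) a * (ln (pmf (q s) a) - ln (pmf (p s) a))) + L s - V s = 0" for s
    using advantage_eq[where p = p and s = s, OF L] policy_value_eq[OF \<gamma>, of T lam f p s]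
    by (simp add: advantage_def V_def)
  have adv_q: "advantage T \<gamma> lam f q V s = L s - V s" for s
    using advantage_eq[where p = q and s = s, OF L] by simp
  have ge: "L s - V s \<ge> 0" for s
    using adv_p[of s] gibbs_le[OF q[of s], of "p s"] lam by (smt (verit) mult_nonneg_nonpos)
  \<comment> \<open>Optimality caps the value of \<open>q\<close> by \<open>V\<close>, while
    \<open>q\<close> gains at least its advantage \<open>L s - V s\<close>.\<close>
  have "L s - V s \<le> 0" for s
  proof -
    have "policy_value T \<gamma> lam f q s \<le> optimal_value T \<gamma> lam f s"
      unfolding optimal_value_def by (intro cSUP_upper bdd_above_policy_value assms) auto
    also have "\<dots> = V s"
      using opt by (simp add: is_optimal_policy_def V_def)
    finally show ?thesis
      using policy_value_ge[OF \<gamma>, of T lam f q V s] ge by (simp add: adv_q)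
  qed
  then have LV: "L s = V s" for s using ge[of s] by (simp add: order.antisym)
  have "p s = q s" for s
    using adv_p[of s] lam by (intro gibbs_eqD[OF q]) (simp add: LV)
  then show "\<exists>V. \<forall>s a. pmf (p s) a > 0 \<and> f s a + \<gamma> * next_value T V s a = lam * ln (pmf (p s) a) + V s"
    using q L LV by auto
next
  assume "\<exists>V. \<forall>s a. pmf (p s) a > 0 \<and> f s a + \<gamma> * next_value T V s a = lam * ln (pmf (p s) a) + V s"
  then obtain V where p: "\<And>s a. pmf (p s) a > 0"
    and V: "\<And>s a. f s a + \<gamma> * next_value T V s a = lam * ln (pmf (p s) a) + V s" by auto
  \<comment> \<open>The equation makes \<open>p\<close> its own softmax policy for \<open>V\<close>,
    so no policy has a positive advantage and that of \<open>p\<close> is \<open>0\<close>.\<close>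
  have "advantage T \<gamma> lam f p' V s \<le> 0" for p' s
    unfolding advantage_eq[OF V] using gibbs_le[OF p[of s], of "p' s"] lam
    by (simp add: mult_nonneg_nonpos)
  then have le: "policy_value T \<gamma> lam f p' s \<le> V s" for p' s
    using policy_value_le[OF \<gamma>, of T lam f p' V 0 s] by simp
  have "advantage T \<gamma> lam f p V s = 0" for s
    unfolding advantage_eq[OF V] by simp
  then have ge: "policy_value T \<gamma> lam f p s \<ge> V s" for s
    using policy_value_ge[OF \<gamma>, of T lam f p V s] by simp
  have "optimal_value T \<gamma> lam f s = policy_value T \<gamma> lam f p s" for s
    unfolding optimal_value_def by (rule cSup_eq_maximum) (auto intro: order.trans[OF le ge])
  then show "is_optimal_policy T \<gamma> lam f p"
    by (simp add: is_optimal_policy_def)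
qed

section \<open>Identifiability in terms of value differences\<close>

lemma next_value_const [simp]: "next_value T (\<lambda>_. c) s a = c"
  for T :: "'s::finite \<Rightarrow> 'a \<Rightarrow> 's pmf"
  by (simp add: next_value_def flip: sum_distrib_right)

lemma next_value_add: "next_value T (\<lambda>s. V s + W s) s a = next_value T V s a + next_value T W s a"
  by (simp add: next_value_def distrib_left sum.distrib)

text \<open>Removes policy and reward from the question: once \<open>p\<close> is optimal for some
  action-independent reward, only the transitions matter.\<close>

lemma irl_identifiable_iff:
  fixes T :: "'s::finite \<Rightarrow> 'a::finite \<Rightarrow> 's pmf"
  assumes \<gamma>: "0 < \<gamma>" "\<gamma> < 1" and lam: "lam > 0"
    and opt: "is_optimal_policy T \<gamma> lam (\<lambda>s a. f\<^sub>0 s) p"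
  shows "action_independent_irl_identifiable T \<gamma> lam p \<longleftrightarrow>
    (\<forall>W. (\<forall>s a a'. next_value T W s a = next_value T W s a') \<longrightarrow> (\<exists>c. \<forall>s. W s = c))"
    (is "?I \<longleftrightarrow> ?K")
proof
  assume I: ?I
  show ?K
  proof (intro allI impI)
    fix W assume W: "\<forall>s a a'. next_value T W s a = next_value T W s a'"
    define w where "w s = next_value T W s undefined" for s
    have w: "next_value T W s a = w s" for s a unfolding w_def using W by blast
    obtain V where p: "\<And>s a. pmf (p s) a > 0"
      and V: "\<And>s a. f\<^sub>0 s + \<gamma> * next_value T V s a = lam * ln (pmf (p s) a) + V s"
      using opt unfolding is_optimal_policy_iff[OF \<gamma> lam] by blast
    have "is_optimal_policy T \<gamma> lam (\<lambda>s a. f\<^sub>0 s + W s - \<gamma> * w s) p"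
      unfolding is_optimal_policy_iff[OF \<gamma> lam]
    proof (intro exI allI conjI p)
      fix s a
      show "f\<^sub>0 s + W s - \<gamma> * w s + \<gamma> * next_value T (\<lambda>s. V s + W s) s a =
          lam * ln (pmf (p s) a) + (V s + W s)"
        using V[of s a] by (simp add: next_value_add w algebra_simps)
    qed
    with opt I[unfolded action_independent_irl_identifiable_def, rule_format,
        of f\<^sub>0 "\<lambda>s. f\<^sub>0 s + W s - \<gamma> * w s"]
    obtain c where "\<forall>s. f\<^sub>0 s + W s - \<gamma> * w s = f\<^sub>0 s + c"
      by auto
    then have c: "W s = c + \<gamma> * w s" for s by (simp add: algebra_simps)
    have avg: "policy_avg p (next_value T W) s = w s"
      "policy_avg p (next_value T (\<lambda>s. - W s)) s = - w s" for s
    proof -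
      have "next_value T (\<lambda>s. - W s) s a = - w s" for s a
        using w[of s a] by (simp add: next_value_def sum_negf)
      then show "policy_avg p (next_value T W) s = w s"
        "policy_avg p (next_value T (\<lambda>s. - W s)) s = - w s"
        by (simp_all add: policy_avg_def w sum_negf flip: sum_distrib_right)
    qed
    \<comment> \<open>\<open>W\<close> solves the evaluation equation with constant reward
      \<open>c\<close>; the maximum principle for \<open>W\<close> and \<open>- W\<close> pins it to
      \<open>c / (1 - \<gamma>)\<close>.\<close>
    have "W s \<le> c + \<gamma> * policy_avg p (next_value T W) s"
      "- W s \<le> - c + \<gamma> * policy_avg p (next_value T (\<lambda>s. - W s)) s" for s
      unfolding avg using c[of s] by simp_all
    from this[THEN discounted_max_principle[OF \<gamma>]]
    have "W s \<le> c / (1 - \<gamma>)" "- W s \<le> - c / (1 - \<gamma>)" for s by blast+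
    then have "W s = c / (1 - \<gamma>)" for s by (simp add: order.antisym)
    then show "\<exists>c. \<forall>s. W s = c" by blast
  qed
next
  assume K: ?K
  show ?I
    unfolding action_independent_irl_identifiable_def
  proof (intro allI impI, elim conjE)
    fix f f' :: "'s \<Rightarrow> real"
    assume f: "is_optimal_policy T \<gamma> lam (\<lambda>s a. f s) p" and f': "is_optimal_policy T \<gamma> lam (\<lambda>s a. f' s) p"
    from f obtain V where V: "\<And>s a. f s + \<gamma> * next_value T V s a = lam * ln (pmf (p s) a) + V s"
      unfolding is_optimal_policy_iff[OF \<gamma> lam] by blast
    from f' obtain V' where V': "\<And>s a. f' s + \<gamma> * next_value T V' s a = lam * ln (pmf (p s) a) + V' s"
      unfolding is_optimal_policy_iff[OF \<gamma> lam] by blast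
    define W where "W s = V' s - V s" for s
    \<comment> \<open>The policy terms cancel on subtraction and the right side is free of
      \<open>a\<close>; dividing by \<open>\<gamma> > 0\<close> then gives action
      independence.\<close>
    have nW: "\<gamma> * next_value T W s a = W s - (f' s - f s)" for s a
      using V[of s a] V'[of s a]
      by (simp add: W_def next_value_def right_diff_distrib sum_subtractf)
    then have "next_value T W s a = next_value T W s a'" for s a a'
      using \<gamma> by (metis mult_cancel_left less_irrefl)
    with K obtain c where c: "\<And>s. W s = c" by blast
    then have "W = (\<lambda>_. c)" by auto
    then have "f' s = f s + (c - \<gamma> * c)" for s
      using nW[of s undefined] by simp
    then show "\<exists>c. \<forall>s. f' s = f s + c" by blast
  qed
qed

subsection \<open>Linked states\<close>

lemma next_value_eq_const:
  fixes T :: "'s::finite \<Rightarrow> 'a \<Rightarrow> 's pmf"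
  assumes "\<And>s'. s' \<in> future_states T s \<Longrightarrow> W s' = c"
  shows "next_value T W s a = c"
proof -
  have "pmf (T s a) s' * W s' = pmf (T s a) s' * c" for s'
    using assms[of s'] pmf_nonneg[of "T s a" s'] by (cases "pmf (T s a) s' = 0") (auto simp: future_states_def less_le)
  then have "next_value T W s a = next_value T (\<lambda>_. c) s a"
    unfolding next_value_def by (intro sum.cong refl)
  then show ?thesis by simp
qed

text \<open>A positive probability must be \<open>1\<close>, which leaves no mass elsewhere.\<close>

lemma deterministic_next_value:
  fixes T :: "'s::finite \<Rightarrow> 'a \<Rightarrow> 's pmf"
  assumes "deterministic_transitions T" and "pmf (T s a) s' > 0"
  shows "next_value T W s a = W s'"
proof -
  have one: "pmf (T s a) s' = 1"
    using assms unfolding deterministic_transitions_def by (metis insertE singletonD less_irrefl)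
  have "(\<Sum>x\<in>UNIV. pmf (T s a) x) = pmf (T s a) s' + (\<Sum>x\<in>UNIV - {s'}. pmf (T s a) x)"
    by (rule sum.remove) auto
  then have "(\<Sum>x\<in>UNIV - {s'}. pmf (T s a) x) = 0" by (simp add: one)
  then have "pmf (T s a) x = 0" if "x \<noteq> s'" for x
    using that by (subst (asm) sum_nonneg_eq_0_iff) auto
  then have "next_value T W s a = (\<Sum>x\<in>{s'}. pmf (T s a) x * W x)"
    unfolding next_value_def by (intro sum.mono_neutral_right) auto
  with one show ?thesis by simp
qed

text \<open>Full rank makes the transition vectors span every vector supported on the future states,
  including \<open>axis s' 1\<close>. The vector \<open>W - c\<close> is orthogonal to all of them,
  so it vanishes at \<open>s'\<close>.\<close>

lemma full_rank_const_on_future_states: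
  fixes T :: "'s::finite \<Rightarrow> 'a \<Rightarrow> 's pmf"
  assumes rank: "transition_rank T s = card (future_states T s)"
    and W: "\<And>a. next_value T W s a = c" and s': "s' \<in> future_states T s"
  shows "W s' = c"
proof -
  let ?d = "(\<lambda>i. axis i 1 :: real ^ 's) ` future_states T s"
  let ?R = "range (\<lambda>a. (\<chi> s'. pmf (T s a) s') :: real ^ 's)"
  let ?S = "{x::real ^ 's. \<forall>i\<in>Basis. i \<notin> ?d \<longrightarrow> x \<bullet> i = 0}"
  have d: "?d \<subseteq> Basis" by (auto simp: Basis_vec_def)
  have card: "card ?d = card (future_states T s)"
    by (intro card_image inj_onI) (simp add: axis_eq_axis)
  have "subspace ?S" by (rule subspace_substandard)
  moreover have "?R \<subseteq> ?S"
  proof (clarsimp simp: Basis_vec_def inner_axis)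
    fix a i assume "axis i 1 \<notin> ?d"
    then have "i \<notin> future_states T s" by blast
    then show "pmf (T s a) i = 0"
      using pmf_nonneg[of "T s a" i] by (auto simp: future_states_def less_le)
  qed
  ultimately have "span ?R \<subseteq> ?S" by (intro span_minimal)
  moreover have "dim (span ?R) = dim ?S"
    unfolding dim_substandard[OF d] card using rank by (simp add: transition_rank_def)
  ultimately have "span ?R = ?S"
    using \<open>subspace ?S\<close> by (intro subspace_dim_equal) auto
  moreover have "axis s' 1 \<in> ?S"
    using s' by (auto simp: Basis_vec_def inner_axis_axis)
  ultimately have mem: "axis s' 1 \<in> span ?R" by simp
  \<comment> \<open>Transition vectors have total mass \<open>1\<close>, so subtracting
    \<open>c\<close> turns equal averages into orthogonality.\<close>
  define w :: "real ^ 's" where "w = (\<chi> x. W x - c)"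
  have "w \<bullet> x = 0" if "x \<in> ?R" for x
  proof -
    from that obtain a where "x = (\<chi> s'. pmf (T s a) s')" by auto
    then have "w \<bullet> x = next_value T W s a - c"
      by (simp add: w_def inner_vec_def next_value_def left_diff_distrib sum_subtractf mult.commute
          flip: sum_distrib_left)
    with W show ?thesis by simp
  qed
  then have "?R \<subseteq> {x. w \<bullet> x = 0}" by blast
  then have "span ?R \<subseteq> {x. w \<bullet> x = 0}"
    by (intro span_minimal subspace_hyperplane)
  with mem have "w \<bullet> axis s' 1 = 0" by blast
  then show ?thesis by (simp add: w_def inner_axis)
qed

text \<open>Connectedness via locally constant functions: links propagate values of
  \<open>W\<close>, and an indicator separates distinct classes. As \<open>linked\<close> is not
  reflexive, a state without predecessor must be separated too, which takes a second state.\<close>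

lemma reward_decomposable_iff:
  fixes T :: "'s::finite \<Rightarrow> 'a \<Rightarrow> 's pmf"
  assumes "CARD('s) \<ge> 2"
  shows "reward_decomposable T \<longleftrightarrow>
    (\<forall>W :: 's \<Rightarrow> real. (\<forall>s. \<exists>c. \<forall>s'\<in>future_states T s. W s' = c) \<longrightarrow> (\<exists>c. \<forall>s. W s = c))"
    (is "_ \<longleftrightarrow> ?K")
proof
  assume dec: "reward_decomposable T"
  show ?K
  proof (intro allI impI)
    fix W :: "'s \<Rightarrow> real"
    assume W: "\<forall>s. \<exists>c. \<forall>s'\<in>future_states T s. W s' = c"
    have step: "W s = W s'" if "one_step_linked T s s'" for s s'
      using that W unfolding one_step_linked_def future_states_def by (metis mem_Collect_eq)
    have "W s = W s'" if "linked T s s'" for s s'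
      using that unfolding linked_def by (induction rule: tranclp_induct) (auto dest: step)
    with dec show "\<exists>c. \<forall>s. W s = c"
      unfolding reward_decomposable_def by metis
  qed
next
  assume K: ?K
  have sym: "linked T y x" if "linked T x y" for x y
    using that unfolding linked_def
  proof (induction rule: tranclp_induct)
    case (base y)
    then show ?case unfolding one_step_linked_def by blast
  next
    case (step y z)
    from step.hyps(2) have "one_step_linked T z y" unfolding one_step_linked_def by blast
    then show ?case using step.IH by (rule tranclp_into_tranclp2)
  qed
  have trans: "linked T x z" if "linked T x y" "linked T y z" for x y z
    using that unfolding linked_def by (rule tranclp_trans)
  have siblings: "linked T x y" if "x \<in> future_states T s" "y \<in> future_states T s" for x y s
    using that unfolding linked_def one_step_linked_def future_states_def by (intro tranclp.r_into_trancl) blast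
  show "reward_decomposable T"
    unfolding reward_decomposable_def
  proof (intro allI, rule ccontr)
    fix x y assume xy: "\<not> linked T x y"
    \<comment> \<open>\<open>C\<close> is the class of \<open>x\<close>, or \<open>{x}\<close> if \<open>x\<close> has no predecessor.\<close>
    obtain C where C: "\<And>s u v. u \<in> future_states T s \<Longrightarrow> v \<in> future_states T s \<Longrightarrow> u \<in> C \<Longrightarrow> v \<in> C"
      and "C \<noteq> {}" "C \<noteq> UNIV"
    proof (cases "linked T x x")
      case True
      show ?thesis
        by (rule that[of "{u. linked T x u}"]) (use True xy siblings trans in blast)+
    next
      case False
      have "{x} \<noteq> UNIV"
      proof
        assume eq: "{x} = UNIV"
        have "card {x} = 1" by simp
        with assms show False unfolding eq by linarith
      qed
      \<comment> \<open>No set of successors contains \<open>x\<close>, so the closure condition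
        holds vacuously for \<open>{x}\<close>.\<close>
      then show ?thesis
        by (intro that[of "{x}"]) (use False siblings in blast)+
    qed
    \<comment> \<open>Each set of successors lies inside \<open>C\<close> or misses it.\<close>
    have "\<exists>c. \<forall>s'\<in>future_states T s. (indicator C s' :: real) = c" for s
    proof (cases "future_states T s \<inter> C = {}")
      case True
      then have "\<forall>s'\<in>future_states T s. indicator C s' = (0::real)"
        by (auto simp: indicator_def)
      then show ?thesis by blast
    next
      case False
      then have "future_states T s \<subseteq> C" using C by blast
      then have "\<forall>s'\<in>future_states T s. indicator C s' = (1::real)"
        by (auto simp: indicator_def)
      then show ?thesis by blast
    qed
    from K[rule_format, of "indicator C", OF this]
    obtain c where c: "\<And>s. indicator C s = (c::real)" by auto
    obtain u v where "u \<in> C" "v \<notin> C" using \<open>C \<noteq> {}\<close> \<open>C \<noteq> UNIV\<close> by blast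
    with c[of u] c[of v] show False by simp
  qed
qed

section \<open>Equivalence of identifiability and decomposability\<close>

theorem corollary4:
  fixes T :: "'s::finite \<Rightarrow> 'a::finite \<Rightarrow> 's pmf"
    and \<gamma> lam :: real
    and \<pi> :: "'s \<Rightarrow> 'a pmf"
  assumes "CARD('s) \<ge> 2" and "CARD('a) \<ge> 2"
    and "0 < \<gamma>" and "\<gamma> < 1" and "lam > 0"
    and "deterministic_transitions T \<or>
         (\<forall>s. transition_rank T s = card (future_states T s))"
    and "\<exists>f :: 's \<Rightarrow> real. is_optimal_policy T \<gamma> lam (\<lambda>s a. f s) \<pi>"
  shows "action_independent_irl_identifiable T \<gamma> lam \<pi> \<longleftrightarrow> reward_decomposable T"
proof -
  \<comment> \<open>Here the structural assumption enters: it recovers \<open>W\<close> on the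
    successors from its averages, which matches the conditions on \<open>W\<close> in the two
    characterisations.\<close>
  have key: "(\<forall>a a'. next_value T W s a = next_value T W s a') \<longleftrightarrow> (\<exists>c. \<forall>s'\<in>future_states T s. W s' = c)"
    for W :: "'s \<Rightarrow> real" and s
  proof
    assume "\<forall>a a'. next_value T W s a = next_value T W s a'"
    then have W: "next_value T W s a = next_value T W s undefined" for a by blast
    have "W s' = next_value T W s undefined" if s': "s' \<in> future_states T s" for s'
      using assms(6)
    proof
      assume "deterministic_transitions T"
      moreover obtain a where "pmf (T s a) s' > 0" using s' unfolding future_states_def by blast
      ultimately show ?thesis using deterministic_next_value W by metis
    next
      assume "\<forall>s. transition_rank T s = card (future_states T s)"
      then show ?thesis using full_rank_const_on_future_states W s' by blast
    qed
    then show "\<exists>c. \<forall>s'\<in>future_states T s. W s' = c" by blast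
  next
    assume "\<exists>c. \<forall>s'\<in>future_states T s. W s' = c"
    then show "\<forall>a a'. next_value T W s a = next_value T W s a'"
      using next_value_eq_const[of T s W] by metis
  qed
  obtain f where f: "is_optimal_policy T \<gamma> lam (\<lambda>s a. f s) \<pi>" using assms(7) by blast
  show ?thesis
    unfolding irl_identifiable_iff[OF assms(3-5) f] reward_decomposable_iff[OF assms(1)] key ..
qed

end
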